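(* Let $M^2_1$ be a Lorentz surface of general type in $\mathbb{E}^4_2$ with geometric functions $\nu_1,\nu_2,\mu$. Then $M^2_1$ has constant normal curvature $\varkappa$ if and only if the function $\mu(\nu_1+\nu_2)$ is constant.
   Context: $\mathbb{E}^4_2$ is $\mathbb{R}^4$ with the standard orientation and the metric $\langle\cdot,\cdot\rangle=dx_1^2+dx_2^2-dx_3^2-dx_4^2$; $\nabla'$ is its Levi-Civita connection. A Lorentz surface $M^2_1:z=z(u,v)$, $(u,v)$ in a (connected) domain of $\mathbb{R}^2$, is a smooth immersed surface whose induced metric has signature $(1,1)$. $\sigma$ is its second fundamental form (normal part of $\nabla'_XY$), $D$ its normal connection (normal part of $\nabla'_X\xi$ for normal $\xi$), and $H=\frac12\operatorname{tr}\sigma=\frac12(\sigma(x,x)-\sigma(y,y))$ for tangent orthonormal $x,y$ with $\langle x,x\rangle=1$, $\langle y,y\rangle=-1$. Write $E=\langle z_u,z_u\rangle>0$, $F=\langle z_u,z_v\rangle$, $G=\langle z_v,z_v\rangle<0$ (parameters are always taken with these signs), $W=\sqrt{|EG-F^2|}$. For a normal frame field $n_1,n_2$ with $\langle n_1,n_1\rangle=1$, $\langle n_2,n_2\rangle=-1$, $\langle n_1,n_2\rangle=0$ and $(z_u,z_v,n_1,n_2)$ positively oriented put $c_{11}^k=\langle z_{uu},n_k\rangle$, $c_{12}^k=\langle z_{uv},n_k\rangle$, $c_{22}^k=\langle z_{vv},n_k\rangle$, $\Delta_1=c_{11}^1c_{12}^2-c_{12}^1c_{11}^2$, $\Delta_2=c_{11}^1c_{22}^2-c_{22}^1c_{11}^2$,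 $\Delta_3=c_{12}^1c_{22}^2-c_{22}^1c_{12}^2$, $L=2\Delta_1/W$, $M=\Delta_2/W$, $N=2\Delta_3/W$, $k=\frac{LN-M^2}{EG-F^2}$, $\varkappa=\frac{EN+GL-2FM}{2(EG-F^2)}$. The function $\varkappa$ is the normal curvature (curvature of the normal connection), i.e. $\varkappa=\langle R^\perp(x,y)n_2,n_1\rangle$ for a positively oriented orthonormal quadruple $\{x,y,n_1,n_2\}$ with $x,n_1$ spacelike and $y,n_2$ timelike, where $R^\perp$ is the curvature tensor of $D$. A Lorentz surface of general type is one that is free of flat points, i.e. $(L,M,N)\ne(0,0,0)$ everywhere, satisfies $\varkappa^2-k>0$ everywhere, and whose mean curvature vector $H$ is at each point non-zero and either spacelike ($\langle H,H\rangle>0$) or timelike ($\langle H,H\rangle<0$). Set $\varepsilon=\operatorname{sign}\langle H,H\rangle$. Parameters are principal if $F=0$ and $M=0$; since $\varkappa^2-k>0$, the surface is assumed parametrized by principal parameters. Put $x=z_u/\sqrt{E}$, $y=z_v/\sqrt{-G}$, $b=\varepsilon H/\sqrt{\varepsilon\langle H,H\rangle}$ (so $\langle b,b\rangle=\varepsilon$), and let $l$ be the normal field with $\langle l,l\rangle=-\varepsilon$, $\langle b,l\rangle=0$, such that $(x,y,b,l)$ is positively oriented if $\varepsilon=1$ and $(x,y,l,b)$ is positively oriented if $\varepsilon=-1$. The geometric functions are $\nu_1=\langle\sigma(x,x),b\rangle$, $\nu_2=\langle\sigma(y,y),b\rangle$, $\mu=\langle\sigma(x,y),l\rangle$. *)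

theory Defs
  imports "HOL-Analysis.Analysis"
begin

section \<open>The pseudo-Euclidean space with neutral metric\<close>

definition nip :: "real^4 \<Rightarrow> real^4 \<Rightarrow> real" where
  "nip x y = x$1 * y$1 + x$2 * y$2 - x$3 * y$3 - x$4 * y$4"

definition pos_oriented :: "real^4 \<Rightarrow> real^4 \<Rightarrow> real^4 \<Rightarrow> real^4 \<Rightarrow> bool" where
  "pos_oriented w1 w2 w3 w4 \<longleftrightarrow> det (vector [w1, w2, w3, w4] :: real^4^4) > 0"


section \<open>Maps on the parameter domain\<close>

type_synonym param = "real \<times> real"

text \<open>A tangent vector at the point with parameters \<open>p\<close> is given by its coordinates
  \<open>a :: param\<close> with respect to \<open>z\<^sub>u, z\<^sub>v\<close>; it stands for \<open>dd z a p\<close>. As the ambient connection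
  is flat, \<open>dd \<xi> a p\<close> is the ambient covariant derivative of a vector field \<open>\<xi>\<close> along the
  surface.\<close>

definition dd :: "(param \<Rightarrow> real^4) \<Rightarrow> param \<Rightarrow> param \<Rightarrow> real^4" where
  "dd f a p = frechet_derivative f (at p) a"

primrec k_smooth_on :: "nat \<Rightarrow> param set \<Rightarrow> (param \<Rightarrow> real^4) \<Rightarrow> bool" where
  "k_smooth_on 0 U f \<longleftrightarrow> continuous_on U f"
| "k_smooth_on (Suc k) U f \<longleftrightarrow>
     (\<forall>p\<in>U. f differentiable (at p)) \<and> (\<forall>a. k_smooth_on k U (dd f a))"

definition smooth_on :: "param set \<Rightarrow> (param \<Rightarrow> real^4) \<Rightarrow> bool" where
  "smooth_on U f \<longleftrightarrow> (\<forall>k. k_smooth_on k U f)"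

definition z_u :: "(param \<Rightarrow> real^4) \<Rightarrow> param \<Rightarrow> real^4" where
  "z_u z = dd z (1, 0)"

definition z_v :: "(param \<Rightarrow> real^4) \<Rightarrow> param \<Rightarrow> real^4" where
  "z_v z = dd z (0, 1)"


section \<open>Lorentz surfaces\<close>

definition ff_E :: "(param \<Rightarrow> real^4) \<Rightarrow> param \<Rightarrow> real" where
  "ff_E z p = nip (z_u z p) (z_u z p)"

definition ff_F :: "(param \<Rightarrow> real^4) \<Rightarrow> param \<Rightarrow> real" where
  "ff_F z p = nip (z_u z p) (z_v z p)"

definition ff_G :: "(param \<Rightarrow> real^4) \<Rightarrow> param \<Rightarrow> real" where
  "ff_G z p = nip (z_v z p) (z_v z p)"

definition ff_W :: "(param \<Rightarrow> real^4) \<Rightarrow> param \<Rightarrow> real" where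
  "ff_W z p = sqrt \<bar>ff_E z p * ff_G z p - (ff_F z p)\<^sup>2\<bar>"

text \<open>The signs of \<open>E\<close> and \<open>G\<close> give \<open>EG - F\<^sup>2 < 0\<close>, i.e. signature (1,1) of the induced metric.\<close>

definition lorentz_surface :: "param set \<Rightarrow> (param \<Rightarrow> real^4) \<Rightarrow> bool" where
  "lorentz_surface U z \<longleftrightarrow>
     open U \<and> connected U \<and> U \<noteq> {} \<and> smooth_on U z \<and>
     (\<forall>p\<in>U. inj (frechet_derivative z (at p))) \<and>
     (\<forall>p\<in>U. ff_E z p > 0 \<and> ff_G z p < 0)"

definition tangent_space :: "(param \<Rightarrow> real^4) \<Rightarrow> param \<Rightarrow> (real^4) set" where
  "tangent_space z p = range (\<lambda>a. dd z a p)"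

definition normal_space :: "(param \<Rightarrow> real^4) \<Rightarrow> param \<Rightarrow> (real^4) set" where
  "normal_space z p = {\<xi>. \<forall>t\<in>tangent_space z p. nip \<xi> t = 0}"

text \<open>Since the induced metric is non-degenerate, the decomposition into a tangent and a normal
  part exists and is unique.\<close>

definition normal_part :: "(param \<Rightarrow> real^4) \<Rightarrow> param \<Rightarrow> real^4 \<Rightarrow> real^4" where
  "normal_part z p w = (THE \<xi>. \<xi> \<in> normal_space z p \<and> w - \<xi> \<in> tangent_space z p)"

text \<open>The second argument is extended to the tangent field with constant coordinates \<open>b\<close>;
  the result is tensorial, so the extension does not matter.\<close>

definition second_form :: "(param \<Rightarrow> real^4) \<Rightarrow> param \<Rightarrow> param \<Rightarrow> param \<Rightarrow> real^4" where
  "second_form z p a b = normal_part z p (dd (dd z b) a p)"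

text \<open>An orthonormal tangent frame for arbitrary parameters, obtained from \<open>z\<^sub>u, z\<^sub>v\<close> by
  Gram-Schmidt: \<open>x = z\<^sub>u / \<surd>E\<close> is spacelike and \<open>y = (E z\<^sub>v - F z\<^sub>u) / (\<surd>E W)\<close> is timelike, with the
  orientation of \<open>(z\<^sub>u, z\<^sub>v)\<close>.\<close>

definition frame_x :: "(param \<Rightarrow> real^4) \<Rightarrow> param \<Rightarrow> param" where
  "frame_x z p = (1 / sqrt (ff_E z p), 0)"

definition frame_y :: "(param \<Rightarrow> real^4) \<Rightarrow> param \<Rightarrow> param" where
  "frame_y z p = (1 / (sqrt (ff_E z p) * ff_W z p)) *\<^sub>R (- ff_F z p, ff_E z p)"

definition mean_curvature_vector :: "(param \<Rightarrow> real^4) \<Rightarrow> param \<Rightarrow> real^4" where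
  "mean_curvature_vector z p =
     (1/2) *\<^sub>R (second_form z p (frame_x z p) (frame_x z p)
              - second_form z p (frame_y z p) (frame_y z p))"


section \<open>Normal frames and the invariants of the surface\<close>

definition normal_frame ::
  "param set \<Rightarrow> (param \<Rightarrow> real^4) \<Rightarrow> (param \<Rightarrow> real^4) \<Rightarrow> (param \<Rightarrow> real^4) \<Rightarrow> bool" where
  "normal_frame U z n1 n2 \<longleftrightarrow>
     smooth_on U n1 \<and> smooth_on U n2 \<and>
     (\<forall>p\<in>U. n1 p \<in> normal_space z p \<and> n2 p \<in> normal_space z p \<and>
        nip (n1 p) (n1 p) = 1 \<and> nip (n2 p) (n2 p) = -1 \<and> nip (n1 p) (n2 p) = 0 \<and>
        pos_oriented (z_u z p) (z_v z p) (n1 p) (n2 p))"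

definition c11 :: "(param \<Rightarrow> real^4) \<Rightarrow> (param \<Rightarrow> real^4) \<Rightarrow> param \<Rightarrow> real" where
  "c11 z n p = nip (dd (z_u z) (1, 0) p) (n p)"

definition c12 :: "(param \<Rightarrow> real^4) \<Rightarrow> (param \<Rightarrow> real^4) \<Rightarrow> param \<Rightarrow> real" where
  "c12 z n p = nip (dd (z_u z) (0, 1) p) (n p)"

definition c22 :: "(param \<Rightarrow> real^4) \<Rightarrow> (param \<Rightarrow> real^4) \<Rightarrow> param \<Rightarrow> real" where
  "c22 z n p = nip (dd (z_v z) (0, 1) p) (n p)"

context
  fixes z n1 n2 :: "param \<Rightarrow> real^4" and p :: param
begin

definition Delta1 :: real where
  "Delta1 = c11 z n1 p * c12 z n2 p - c12 z n1 p * c11 z n2 p"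

definition Delta2 :: real where
  "Delta2 = c11 z n1 p * c22 z n2 p - c22 z n1 p * c11 z n2 p"

definition Delta3 :: real where
  "Delta3 = c12 z n1 p * c22 z n2 p - c22 z n1 p * c12 z n2 p"

definition inv_L :: real where "inv_L = 2 * Delta1 / ff_W z p"
definition inv_M :: real where "inv_M = Delta2 / ff_W z p"
definition inv_N :: real where "inv_N = 2 * Delta3 / ff_W z p"

definition inv_k :: real where
  "inv_k = (inv_L * inv_N - inv_M\<^sup>2) / (ff_E z p * ff_G z p - (ff_F z p)\<^sup>2)"

definition inv_varkappa :: real where
  "inv_varkappa =
     (ff_E z p * inv_N + ff_G z p * inv_L - 2 * ff_F z p * inv_M)
       / (2 * (ff_E z p * ff_G z p - (ff_F z p)\<^sup>2))"

end

definition general_type ::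
  "param set \<Rightarrow> (param \<Rightarrow> real^4) \<Rightarrow> (param \<Rightarrow> real^4) \<Rightarrow> (param \<Rightarrow> real^4) \<Rightarrow> bool" where
  "general_type U z n1 n2 \<longleftrightarrow>
     (\<forall>p\<in>U.
        (inv_L z n1 n2 p, inv_M z n1 n2 p, inv_N z n1 n2 p) \<noteq> (0, 0, 0) \<and>
        (inv_varkappa z n1 n2 p)\<^sup>2 - inv_k z n1 n2 p > 0 \<and>
        mean_curvature_vector z p \<noteq> 0 \<and>
        (nip (mean_curvature_vector z p) (mean_curvature_vector z p) > 0 \<or>
         nip (mean_curvature_vector z p) (mean_curvature_vector z p) < 0))"

definition principal_parameters ::
  "param set \<Rightarrow> (param \<Rightarrow> real^4) \<Rightarrow> (param \<Rightarrow> real^4) \<Rightarrow> (param \<Rightarrow> real^4) \<Rightarrow> bool" where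
  "principal_parameters U z n1 n2 \<longleftrightarrow> (\<forall>p\<in>U. ff_F z p = 0 \<and> inv_M z n1 n2 p = 0)"


section \<open>Normal curvature\<close>

definition normal_connection ::
  "(param \<Rightarrow> real^4) \<Rightarrow> param \<Rightarrow> (param \<Rightarrow> real^4) \<Rightarrow> param \<Rightarrow> real^4" where
  "normal_connection z a \<xi> p = normal_part z p (dd \<xi> a p)"

text \<open>Here \<open>a\<close> and \<open>b\<close> are extended to tangent fields with constant coordinates. These commute,
  so the term with the Lie bracket vanishes; the curvature is tensorial, so the extension does not
  matter.\<close>

definition normal_curvature_tensor ::
  "(param \<Rightarrow> real^4) \<Rightarrow> param \<Rightarrow> param \<Rightarrow> (param \<Rightarrow> real^4) \<Rightarrow> param \<Rightarrow> real^4" where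
  "normal_curvature_tensor z a b \<xi> p =
     normal_connection z a (normal_connection z b \<xi>) p
   - normal_connection z b (normal_connection z a \<xi>) p"

definition normal_curvature ::
  "(param \<Rightarrow> real^4) \<Rightarrow> (param \<Rightarrow> real^4) \<Rightarrow> (param \<Rightarrow> real^4) \<Rightarrow> param \<Rightarrow> real" where
  "normal_curvature z n1 n2 p =
     nip (normal_curvature_tensor z (frame_x z p) (frame_y z p) n2 p) (n1 p)"


section \<open>Geometric functions in principal parameters\<close>

definition eps :: "(param \<Rightarrow> real^4) \<Rightarrow> param \<Rightarrow> real" where
  "eps z p = sgn (nip (mean_curvature_vector z p) (mean_curvature_vector z p))"

definition princ_x :: "(param \<Rightarrow> real^4) \<Rightarrow> param \<Rightarrow> param" where
  "princ_x z p = (1 / sqrt (ff_E z p), 0)"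

definition princ_y :: "(param \<Rightarrow> real^4) \<Rightarrow> param \<Rightarrow> param" where
  "princ_y z p = (0, 1 / sqrt (- ff_G z p))"

definition field_b :: "(param \<Rightarrow> real^4) \<Rightarrow> param \<Rightarrow> real^4" where
  "field_b z p =
     (eps z p / sqrt (eps z p * nip (mean_curvature_vector z p) (mean_curvature_vector z p)))
       *\<^sub>R mean_curvature_vector z p"

text \<open>At each point these conditions determine \<open>l\<close> uniquely.\<close>

definition is_field_l :: "param set \<Rightarrow> (param \<Rightarrow> real^4) \<Rightarrow> (param \<Rightarrow> real^4) \<Rightarrow> bool" where
  "is_field_l U z l \<longleftrightarrow>
     (\<forall>p\<in>U. l p \<in> normal_space z p \<and>
        nip (l p) (l p) = - eps z p \<and> nip (field_b z p) (l p) = 0 \<and>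
        (eps z p = 1 \<longrightarrow>
           pos_oriented (dd z (princ_x z p) p) (dd z (princ_y z p) p) (field_b z p) (l p)) \<and>
        (eps z p = -1 \<longrightarrow>
           pos_oriented (dd z (princ_x z p) p) (dd z (princ_y z p) p) (l p) (field_b z p)))"

definition nu1 :: "(param \<Rightarrow> real^4) \<Rightarrow> param \<Rightarrow> real" where
  "nu1 z p = nip (second_form z p (princ_x z p) (princ_x z p)) (field_b z p)"

definition nu2 :: "(param \<Rightarrow> real^4) \<Rightarrow> param \<Rightarrow> real" where
  "nu2 z p = nip (second_form z p (princ_y z p) (princ_y z p)) (field_b z p)"

definition mu :: "(param \<Rightarrow> real^4) \<Rightarrow> (param \<Rightarrow> real^4) \<Rightarrow> param \<Rightarrow> real" where
  "mu z l p = nip (second_form z p (princ_x z p) (princ_y z p)) (l p)"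

end

theory Submission
  imports Defs
begin

text \<open>The normal curvature and the function \<open>\<mu> (\<nu>\<^sub>1 + \<nu>\<^sub>2)\<close> agree at every point up to the factor
  \<open>\<epsilon> = sign \<langle>H,H\<rangle>\<close>, and \<open>\<epsilon>\<close> is constant on the surface. This gives the equivalence.

  The Ricci equation (\<open>ricci_equation\<close>) expresses the curvature of the normal connection
  through the second fundamental form. Write \<open>\<alpha>\<close>, \<open>\<delta>\<close>, \<open>\<gamma>\<close> for the normal vectors
  \<open>\<sigma>(x,x)\<close>, \<open>\<sigma>(y,y)\<close>, \<open>\<sigma>(x,y)\<close>, and let \<open>v \<and> w\<close> be the \<open>2 \<times> 2\<close> determinant of the products
  of \<open>v, w\<close> with \<open>n\<^sub>1, n\<^sub>2\<close>. If the parameters are orthogonal, the equation reads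
  \<open>\<kappa> = (\<alpha> + \<delta>) \<and> \<gamma>\<close>, which is also the formula defining \<open>\<kappa>\<close> through \<open>E, G, L, N\<close>.

  The second condition on principal parameters, \<open>M = 0\<close>, says \<open>\<alpha> \<and> \<delta> = 0\<close>. As
  \<open>H = (\<alpha> - \<delta>) / 2\<close> is non-zero, both \<open>\<alpha>\<close> and \<open>\<delta>\<close> are then multiples of \<open>b\<close>, namely
  \<open>\<epsilon> \<nu>\<^sub>1 b\<close> and \<open>\<epsilon> \<nu>\<^sub>2 b\<close>. The orientation convention for \<open>l\<close> amounts, for both signs of \<open>\<epsilon>\<close>, to
  \<open>\<langle>l,n\<^sub>1\<rangle> = - \<langle>b,n\<^sub>2\<rangle>\<close> and \<open>\<langle>l,n\<^sub>2\<rangle> = - \<langle>b,n\<^sub>1\<rangle>\<close> (\<open>oriented_unit_normal_components\<close>), that is,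
  \<open>\<mu> = \<langle>\<gamma>,l\<rangle> = b \<and> \<gamma>\<close>. Hence \<open>\<kappa> = \<epsilon> (\<nu>\<^sub>1 + \<nu>\<^sub>2) (b \<and> \<gamma>) = \<epsilon> \<mu> (\<nu>\<^sub>1 + \<nu>\<^sub>2)\<close>
  (\<open>geometric_functions_eq_varkappa\<close>).

  Finally \<open>\<langle>H,H\<rangle>\<close> is continuous and has no zero on the connected domain, so \<open>\<epsilon>\<close> is constant
  (\<open>eps_constant\<close>).\<close>

section \<open>Symmetry of second derivatives\<close>

text \<open>The mean value theorem is applied twice: first in the direction \<open>a\<close> to the difference of \<open>g\<close>
  along two parallel segments, then in the direction \<open>b\<close> to \<open>ga\<close>. The left-hand side is
  symmetric in \<open>a\<close> and \<open>b\<close>, which is what makes the mixed derivatives agree.\<close>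

lemma second_difference_mvt:
  fixes g :: "'a::real_normed_vector \<Rightarrow> real"
  assumes ga: "\<And>q. q \<in> ball p r \<Longrightarrow> ((\<lambda>t. g (q + t *\<^sub>R a)) has_real_derivative ga q) (at 0)"
    and gab: "\<And>q. q \<in> ball p r \<Longrightarrow> ((\<lambda>t. ga (q + t *\<^sub>R b)) has_real_derivative gab q) (at 0)"
    and s: "0 < s" "s * (norm a + norm b) < r"
  shows "\<exists>q\<in>ball p r.
    g (p + s *\<^sub>R a + s *\<^sub>R b) - g (p + s *\<^sub>R a) - g (p + s *\<^sub>R b) + g p = s\<^sup>2 * gab q"
proof -
  have mem: "p + t *\<^sub>R a + u *\<^sub>R b \<in> ball p r" if "0 \<le> t" "t \<le> s" "0 \<le> u" "u \<le> s" for t u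
  proof -
    have "norm (t *\<^sub>R a + u *\<^sub>R b) \<le> t * norm a + u * norm b"
      using norm_triangle_ineq[of "t *\<^sub>R a" "u *\<^sub>R b"] that by simp
    also have "\<dots> \<le> s * norm a + s * norm b"
      using that by (intro add_mono mult_right_mono) auto
    finally have "norm (t *\<^sub>R a + u *\<^sub>R b) < r"
      using s(2) by (simp add: distrib_left)
    moreover have "dist p (p + (t *\<^sub>R a + u *\<^sub>R b)) = norm (t *\<^sub>R a + u *\<^sub>R b)"
      by (simp only: dist_norm add_diff_cancel_left' diff_add_cancel norm_minus_commute[of p])
    ultimately show ?thesis
      by (simp add: add.assoc)
  qed
  have Da: "((\<lambda>t. g (q + t *\<^sub>R a)) has_real_derivative ga (q + t *\<^sub>R a)) (at t)"
    if "q + t *\<^sub>R a \<in> ball p r" for q t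
    using ga[OF that] DERIV_shift[of "\<lambda>t. g (q + t *\<^sub>R a)" "ga (q + t *\<^sub>R a)" 0 t]
    by (simp add: scaleR_add_left add_ac)
  have Db: "((\<lambda>t. ga (q + t *\<^sub>R b)) has_real_derivative gab (q + t *\<^sub>R b)) (at t)"
    if "q + t *\<^sub>R b \<in> ball p r" for q t
    using gab[OF that] DERIV_shift[of "\<lambda>t. ga (q + t *\<^sub>R b)" "gab (q + t *\<^sub>R b)" 0 t]
    by (simp add: scaleR_add_left add_ac)
  define \<phi> where "\<phi> t = g ((p + s *\<^sub>R b) + t *\<^sub>R a) - g (p + t *\<^sub>R a)" for t
  have "\<exists>t. 0 < t \<and> t < s \<and>
    \<phi> s - \<phi> 0 = (s - 0) * (ga ((p + s *\<^sub>R b) + t *\<^sub>R a) - ga (p + t *\<^sub>R a))"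
    unfolding \<phi>_def
    using s(1)
  proof (intro MVT2 DERIV_diff Da)
    fix t assume t: "0 \<le> t" "t \<le> s"
    show "p + s *\<^sub>R b + t *\<^sub>R a \<in> ball p r"
      using mem[of t s] t s(1) by (simp add: add_ac)
    show "p + t *\<^sub>R a \<in> ball p r"
      using mem[of t 0] t s(1) by simp
  qed
  then obtain t where t: "0 < t" "t < s"
    and 1: "\<phi> s - \<phi> 0 = s * (ga ((p + s *\<^sub>R b) + t *\<^sub>R a) - ga (p + t *\<^sub>R a))"
    by auto
  have "\<exists>u. 0 < u \<and> u < s \<and>
    ga ((p + t *\<^sub>R a) + s *\<^sub>R b) - ga ((p + t *\<^sub>R a) + 0 *\<^sub>R b)
      = (s - 0) * gab ((p + t *\<^sub>R a) + u *\<^sub>R b)"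
    using s(1)
  proof (intro MVT2 Db)
    fix u assume "0 \<le> u" "u \<le> s"
    then show "p + t *\<^sub>R a + u *\<^sub>R b \<in> ball p r"
      using mem[of t u] t by simp
  qed
  then obtain u where u: "0 < u" "u < s"
    and 2: "ga ((p + t *\<^sub>R a) + s *\<^sub>R b) - ga (p + t *\<^sub>R a) = s * gab ((p + t *\<^sub>R a) + u *\<^sub>R b)"
    by auto
  have "\<phi> s - \<phi> 0 = s\<^sup>2 * gab ((p + t *\<^sub>R a) + u *\<^sub>R b)"
    using 1 2 by (simp add: add_ac power2_eq_square)
  moreover have "p + t *\<^sub>R a + u *\<^sub>R b \<in> ball p r"
    using mem[of t u] t u by simp
  ultimately show ?thesis
    unfolding \<phi>_def by (intro bexI) (auto simp: add_ac algebra_simps)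
qed

text \<open>For small \<open>s\<close> the same second difference, divided by \<open>s\<^sup>2\<close>, is a value of \<open>gab\<close> and a value
  of \<open>gba\<close> near \<open>p\<close>. So by continuity these two functions cannot differ at \<open>p\<close>.\<close>

lemma mixed_directional_derivatives_commute:
  fixes g :: "'a::real_normed_vector \<Rightarrow> real"
  assumes U: "open U" "p \<in> U"
    and ga: "\<And>q. q \<in> U \<Longrightarrow> ((\<lambda>t. g (q + t *\<^sub>R a)) has_real_derivative ga q) (at 0)"
    and gb: "\<And>q. q \<in> U \<Longrightarrow> ((\<lambda>t. g (q + t *\<^sub>R b)) has_real_derivative gb q) (at 0)"
    and gab: "\<And>q. q \<in> U \<Longrightarrow> ((\<lambda>t. ga (q + t *\<^sub>R b)) has_real_derivative gab q) (at 0)"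
    and gba: "\<And>q. q \<in> U \<Longrightarrow> ((\<lambda>t. gb (q + t *\<^sub>R a)) has_real_derivative gba q) (at 0)"
    and cont: "continuous_on U gab" "continuous_on U gba"
  shows "gab p = gba p"
proof (rule ccontr)
  assume neq: "gab p \<noteq> gba p"
  define e where "e = \<bar>gab p - gba p\<bar> / 2"
  have e: "e > 0"
    using neq by (simp add: e_def)
  have "\<exists>d>0. \<forall>q\<in>U. dist q p < d \<longrightarrow> dist (gab q) (gab p) < e"
    using cont(1) U(2) e unfolding continuous_on_iff by blast
  then obtain d1 where d1: "d1 > 0" "\<And>q. q \<in> U \<Longrightarrow> dist q p < d1 \<Longrightarrow> dist (gab q) (gab p) < e"
    by blast
  have "\<exists>d>0. \<forall>q\<in>U. dist q p < d \<longrightarrow> dist (gba q) (gba p) < e"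
    using cont(2) U(2) e unfolding continuous_on_iff by blast
  then obtain d2 where d2: "d2 > 0" "\<And>q. q \<in> U \<Longrightarrow> dist q p < d2 \<Longrightarrow> dist (gba q) (gba p) < e"
    by blast
  obtain d3 where d3: "d3 > 0" "ball p d3 \<subseteq> U"
    using U open_contains_ball by blast
  define r where "r = min d1 (min d2 d3)"
  have r: "r > 0" "ball p r \<subseteq> U"
    using d1 d2 d3 by (auto simp: r_def)
  \<comment> \<open>The summand \<open>1\<close> covers the case of two zero directions and makes the bound strict.\<close>
  define s where "s = r / (norm a + norm b + 1)"
  have "norm a + norm b + 1 > 0"
    by (smt (verit) norm_ge_zero)
  then have s: "s > 0" "s * (norm a + norm b) < r" "s * (norm b + norm a) < r"
    using r(1) by (auto simp: s_def field_simps)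
  obtain q where q: "q \<in> ball p r"
    "g (p + s *\<^sub>R a + s *\<^sub>R b) - g (p + s *\<^sub>R a) - g (p + s *\<^sub>R b) + g p = s\<^sup>2 * gab q"
    using second_difference_mvt[of p r g a ga b gab s, OF ga gab s(1,2)] r(2) by blast
  obtain q' where q': "q' \<in> ball p r"
    "g (p + s *\<^sub>R b + s *\<^sub>R a) - g (p + s *\<^sub>R b) - g (p + s *\<^sub>R a) + g p = s\<^sup>2 * gba q'"
    using second_difference_mvt[of p r g b gb a gba s, OF gb gba s(1,3)] r(2) by blast
  have "s\<^sup>2 * gab q = s\<^sup>2 * gba q'"
    using q(2) q'(2) unfolding add.assoc[of p] add.commute[of "s *\<^sub>R b"] by linarith
  then have "gab q = gba q'"
    using s(1) by simp
  moreover have "dist (gab q) (gab p) < e" "dist (gba q') (gba p) < e"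
    using q(1) q'(1) d1(2)[of q] d2(2)[of q'] r(2) by (auto simp: r_def dist_commute[of p])
  ultimately show False
    unfolding e_def dist_real_def by (smt (verit) field_sum_of_halves)
qed


section \<open>Directional derivatives of vector fields along the surface\<close>

lemma has_derivative_dd:
  "f differentiable (at p) \<Longrightarrow> (f has_derivative (\<lambda>a. dd f a p)) (at p)"
  unfolding dd_def using frechet_derivative_works by fastforce

lemma dd_eqI: "(f has_derivative f') (at p) \<Longrightarrow> dd f a p = f' a"
  unfolding dd_def using frechet_derivative_at by metis

text \<open>Fields such as \<open>normal_connection z a \<xi>\<close> have a usable formula only on the open domain of
  the surface. A derivative at a point of that domain may be computed from the formula.\<close>

lemma dd_transform_open:
  assumes "open U" "p \<in> U" "\<And>q. q \<in> U \<Longrightarrow> f q = g q" "g differentiable (at p)"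
  shows "dd f a p = dd g a p"
  by (rule dd_eqI, rule has_derivative_transform_within_open[OF has_derivative_dd[OF assms(4)]])
    (use assms in auto)

lemma linear_dd: "f differentiable (at p) \<Longrightarrow> linear (\<lambda>a. dd f a p)"
  using has_derivative_dd has_derivative_linear by blast

lemma dd_coordinates:
  assumes "f differentiable (at p)"
  shows "dd f a p = fst a *\<^sub>R dd f (1, 0) p + snd a *\<^sub>R dd f (0, 1) p"
proof -
  have "a = fst a *\<^sub>R (1, 0) + snd a *\<^sub>R (0, 1)"
    by (cases a) simp
  then have "dd f a p = dd f (fst a *\<^sub>R (1, 0) + snd a *\<^sub>R (0, 1)) p"
    by simp
  then show ?thesis
    by (simp only: linear_add[OF linear_dd[OF assms]] linear_scale[OF linear_dd[OF assms]])
qed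

lemma smooth_on_differentiable: "smooth_on U f \<Longrightarrow> p \<in> U \<Longrightarrow> f differentiable (at p)"
  unfolding smooth_on_def by (metis k_smooth_on.simps(2))

lemma smooth_on_dd: "smooth_on U f \<Longrightarrow> smooth_on U (dd f a)"
  unfolding smooth_on_def by (metis k_smooth_on.simps(2))

lemma smooth_on_continuous: "smooth_on U f \<Longrightarrow> continuous_on U f"
  unfolding smooth_on_def by (metis k_smooth_on.simps(1))

lemma dd_component_derivative:
  assumes "f differentiable (at q)"
  shows "((\<lambda>t. f (q + t *\<^sub>R a) $ i) has_real_derivative dd f a q $ i) (at 0)"
proof -
  have "((\<lambda>t. q + t *\<^sub>R a) has_derivative (\<lambda>t. t *\<^sub>R a)) (at 0)"
    by (auto intro!: derivative_eq_intros)
  then have "((\<lambda>t. f (q + t *\<^sub>R a)) has_derivative (\<lambda>t. dd f (t *\<^sub>R a) q)) (at 0)"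
    using has_derivative_compose[of "\<lambda>t. q + t *\<^sub>R a" _ 0 UNIV f "\<lambda>a. dd f a q"]
      has_derivative_dd[OF assms] by simp
  then have "((\<lambda>t. f (q + t *\<^sub>R a) $ i) has_derivative (\<lambda>t. dd f (t *\<^sub>R a) q $ i)) (at 0)"
    by (rule bounded_linear.has_derivative[OF bounded_linear_vec_nth])
  moreover have "(\<lambda>t. dd f (t *\<^sub>R a) q $ i) = (*) (dd f a q $ i)"
    by (auto simp: linear_scale[OF linear_dd[OF assms]])
  ultimately show ?thesis
    unfolding has_field_derivative_def by simp
qed

lemma dd_commute:
  assumes "open U" "p \<in> U" "smooth_on U f"
  shows "dd (dd f a) b p = dd (dd f b) a p"
proof -
  have "dd (dd f a) b p $ i = dd (dd f b) a p $ i" for i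
    by (rule mixed_directional_derivatives_commute[where U = U and g = "\<lambda>q. f q $ i"
          and ga = "\<lambda>q. dd f a q $ i" and gb = "\<lambda>q. dd f b q $ i" and a = a and b = b])
      (use assms in \<open>auto intro!: dd_component_derivative bounded_linear.continuous_on[OF bounded_linear_vec_nth]
          intro: smooth_on_differentiable smooth_on_dd smooth_on_continuous\<close>)
  then show ?thesis
    by (simp add: vec_eq_iff)
qed


section \<open>Linear algebra of the neutral metric\<close>

lemma bounded_bilinear_nip: "bounded_bilinear nip"
  by (simp flip: bilinear_conv_bounded_bilinear add: bilinear_def)
    (auto intro!: linearI simp: nip_def algebra_simps)

interpretation nip: bounded_bilinear nip
  by (rule bounded_bilinear_nip)

lemmas nip_linear = nip.add_left nip.add_right nip.diff_left nip.diff_right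
  nip.scaleR_left nip.scaleR_right nip.zero_left nip.zero_right nip.minus_left nip.minus_right

lemma nip_commute: "nip x y = nip y x"
  by (simp add: nip_def algebra_simps)

lemma vector_4:
  "(vector [w, x, y, z] :: 'a::zero^4) $ 1 = w"
  "(vector [w, x, y, z] :: 'a::zero^4) $ 2 = x"
  "(vector [w, x, y, z] :: 'a::zero^4) $ 3 = y"
  "(vector [w, x, y, z] :: 'a::zero^4) $ 4 = z"
  unfolding vector_def by simp_all

text \<open>The products of \<open>w\<close> with the \<open>e\<^sub>i\<close> form the image of \<open>w\<close>, with the signs of its last two
  entries changed, under the matrix whose rows are the \<open>e\<^sub>i\<close>; positive orientation makes this
  matrix invertible.\<close>

lemma nip_nondegenerate:
  assumes "pos_oriented e1 e2 e3 e4"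
    and "nip w e1 = 0" "nip w e2 = 0" "nip w e3 = 0" "nip w e4 = 0"
  shows "w = 0"
proof -
  define A where "A = (vector [e1, e2, e3, e4] :: real^4^4)"
  define v where "v = (vector [w$1, w$2, - w$3, - w$4] :: real^4)"
  have "invertible A"
    using assms(1) by (simp add: pos_oriented_def invertible_det_nz A_def)
  moreover have "A *v v = 0"
    using assms(2-5)
    by (simp add: A_def v_def vec_eq_iff forall_4 matrix_vector_mult_def sum_4 vector_4 nip_def
        algebra_simps)
  ultimately have "v = 0"
    by (metis invertible_def matrix_left_invertible_ker)
  then show ?thesis
    by (simp add: v_def vec_eq_iff forall_4 vector_4)
qed

lemma nip_orthogonal_expansion:
  assumes "pos_oriented e1 e2 e3 e4"
    and orth: "nip e1 e2 = 0" "nip e1 e3 = 0" "nip e1 e4 = 0"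
      "nip e2 e3 = 0" "nip e2 e4 = 0" "nip e3 e4 = 0"
    and nonnull: "nip e1 e1 \<noteq> 0" "nip e2 e2 \<noteq> 0" "nip e3 e3 \<noteq> 0" "nip e4 e4 \<noteq> 0"
  shows "w = (nip w e1 / nip e1 e1) *\<^sub>R e1 + (nip w e2 / nip e2 e2) *\<^sub>R e2
    + (nip w e3 / nip e3 e3) *\<^sub>R e3 + (nip w e4 / nip e4 e4) *\<^sub>R e4" (is "w = ?v")
proof -
  have orth': "nip e2 e1 = 0" "nip e3 e1 = 0" "nip e4 e1 = 0"
      "nip e3 e2 = 0" "nip e4 e2 = 0" "nip e4 e3 = 0"
    using orth by (simp_all add: nip_commute)
  have "w - ?v = 0"
    by (rule nip_nondegenerate[OF assms(1)]) (simp_all add: nip_linear orth orth' nonnull)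
  then show ?thesis
    by simp
qed

text \<open>This compares the orientations of two adapted frames: the tangent vectors are rescaled and the
  normal pair is changed by a \<open>2 \<times> 2\<close> matrix, whose determinant decides.\<close>

lemma det4_normal_block:
  "det (vector [s *\<^sub>R w1, t *\<^sub>R w2, a *\<^sub>R w3 + b *\<^sub>R w4, c *\<^sub>R w3 + d *\<^sub>R w4] :: real^4^4)
    = s * t * (a * d - b * c) * det (vector [w1, w2, w3, w4] :: real^4^4)"
proof -
  define V where "V x1 x2 x3 x4 = (vector [x1, x2, x3, x4] :: real^4^4)" for x1 x2 x3 x4
  \<comment> \<open>Multilinearity of \<open>det\<close> in one row is expressed with a conditional that singles out that row.\<close>
  have upd: "(\<chi> i. if i = 1 then y else V x1 x2 x3 x4 $ i) = V y x2 x3 x4"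
    "(\<chi> i. if i = 2 then y else V x1 x2 x3 x4 $ i) = V x1 y x3 x4"
    "(\<chi> i. if i = 3 then y else V x1 x2 x3 x4 $ i) = V x1 x2 y x4"
    "(\<chi> i. if i = 4 then y else V x1 x2 x3 x4 $ i) = V x1 x2 x3 y"
    for x1 x2 x3 x4 y :: "real^4"
    by (simp_all add: V_def vec_eq_iff forall_4 vector_4)
  have scale: "det (V (r *\<^sub>R x1) x2 x3 x4) = r * det (V x1 x2 x3 x4)"
    "det (V x1 (r *\<^sub>R x2) x3 x4) = r * det (V x1 x2 x3 x4)"
    "det (V x1 x2 (r *\<^sub>R x3) x4) = r * det (V x1 x2 x3 x4)"
    "det (V x1 x2 x3 (r *\<^sub>R x4)) = r * det (V x1 x2 x3 x4)" for x1 x2 x3 x4 r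
    using det_row_mul[where k = 1 and c = r and a = "\<lambda>_. x1" and b = "($) (V x1 x2 x3 x4)"]
      det_row_mul[where k = 2 and c = r and a = "\<lambda>_. x2" and b = "($) (V x1 x2 x3 x4)"]
      det_row_mul[where k = 3 and c = r and a = "\<lambda>_. x3" and b = "($) (V x1 x2 x3 x4)"]
      det_row_mul[where k = 4 and c = r and a = "\<lambda>_. x4" and b = "($) (V x1 x2 x3 x4)"]
    unfolding upd scalar_mult_eq_scaleR by simp_all
  have add: "det (V x1 x2 (x3 + y) x4) = det (V x1 x2 x3 x4) + det (V x1 x2 y x4)"
    "det (V x1 x2 x3 (x4 + y)) = det (V x1 x2 x3 x4) + det (V x1 x2 x3 y)" for x1 x2 x3 x4 y
    using det_row_add[where k = 3 and a = "\<lambda>_. x3" and b = "\<lambda>_. y" and c = "($) (V x1 x2 x3 x4)"]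
      det_row_add[where k = 4 and a = "\<lambda>_. x4" and b = "\<lambda>_. y" and c = "($) (V x1 x2 x3 x4)"]
    unfolding upd by simp_all
  have alt: "det (V x1 x2 y y) = 0" for x1 x2 y
    by (rule det_identical_rows[of 3 4]) (simp_all add: V_def row_def vector_4 vec_eq_iff)
  have swap: "det (V x1 x2 x4 x3) = - det (V x1 x2 x3 x4)" for x1 x2 x3 x4
    using alt[of x1 x2 "x3 + x4"] unfolding add by (simp add: alt)
  show ?thesis
    unfolding V_def[symmetric] by (simp add: scale add alt swap[of w1 w2 w4 w3] algebra_simps)
qed


section \<open>Surfaces in orthogonal parameters with a normal frame\<close>

text \<open>This turns each constant product of two fields into a relation between their derivatives: for a
  normal and a tangent field it yields the Weingarten formulas, for unit fields the
  orthogonality of a field to its derivative.\<close>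

lemma dd_nip_const:
  assumes "open U" "p \<in> U" "f differentiable (at p)" "g differentiable (at p)"
    and "\<And>q. q \<in> U \<Longrightarrow> nip (f q) (g q) = c"
  shows "nip (dd f a p) (g p) = - nip (f p) (dd g a p)"
proof -
  have "((\<lambda>q. nip (f q) (g q)) has_derivative
      (\<lambda>h. nip (f p) (dd g h p) + nip (dd f h p) (g p))) (at p)"
    by (intro nip.FDERIV has_derivative_dd assms)
  moreover have "((\<lambda>q. nip (f q) (g q)) has_derivative (\<lambda>h. 0)) (at p)"
    by (rule has_derivative_transform_within_open[OF has_derivative_const[of c] assms(1,2)])
      (simp add: assms(5))
  ultimately have "(\<lambda>h. nip (f p) (dd g h p) + nip (dd f h p) (g p)) = (\<lambda>h. 0)"
    by (rule has_derivative_unique)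
  from fun_cong[OF this, of a] show ?thesis
    by simp
qed

text \<open>The condition \<open>F = 0\<close> makes the frame \<open>(z\<^sub>u, z\<^sub>v, n\<^sub>1, n\<^sub>2)\<close> orthogonal, so coordinates with
  respect to it are, up to normalization, products with the frame vectors.\<close>

locale orthogonal_surface =
  fixes U :: "param set" and z n1 n2 :: "param \<Rightarrow> real^4"
  assumes surface: "lorentz_surface U z"
    and frame: "normal_frame U z n1 n2"
    and orthogonal: "p \<in> U \<Longrightarrow> ff_F z p = 0"
begin

lemma open_U: "open U"
  and connected_U: "connected U"
  and smooth_z: "smooth_on U z"
  and E_pos: "p \<in> U \<Longrightarrow> ff_E z p > 0"
  and G_neg: "p \<in> U \<Longrightarrow> ff_G z p < 0"
  using surface by (auto simp: lorentz_surface_def)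

lemma smooth_z_u: "smooth_on U (z_u z)"
  and smooth_z_v: "smooth_on U (z_v z)"
  unfolding z_u_def z_v_def by (intro smooth_on_dd smooth_z)+

lemma smooth_n1: "smooth_on U n1"
  and smooth_n2: "smooth_on U n2"
  using frame by (auto simp: normal_frame_def)

lemma n1_normal: "p \<in> U \<Longrightarrow> n1 p \<in> normal_space z p"
  and n2_normal: "p \<in> U \<Longrightarrow> n2 p \<in> normal_space z p"
  and oriented: "p \<in> U \<Longrightarrow> pos_oriented (z_u z p) (z_v z p) (n1 p) (n2 p)"
  and nip_n: "p \<in> U \<Longrightarrow> nip (n1 p) (n1 p) = 1" "p \<in> U \<Longrightarrow> nip (n2 p) (n2 p) = -1"
    "p \<in> U \<Longrightarrow> nip (n1 p) (n2 p) = 0" "p \<in> U \<Longrightarrow> nip (n2 p) (n1 p) = 0"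
  using frame nip_commute by (auto simp: normal_frame_def)

lemma dd_z: "p \<in> U \<Longrightarrow> dd z a p = fst a *\<^sub>R z_u z p + snd a *\<^sub>R z_v z p"
  unfolding z_u_def z_v_def
  by (rule dd_coordinates[OF smooth_on_differentiable[OF smooth_z]])

lemma tangent_space_iff:
  assumes "p \<in> U"
  shows "t \<in> tangent_space z p \<longleftrightarrow> (\<exists>a b. t = a *\<^sub>R z_u z p + b *\<^sub>R z_v z p)"
  unfolding tangent_space_def by (auto simp: dd_z[OF assms] image_def)

lemma normal_space_iff:
  assumes "p \<in> U"
  shows "\<xi> \<in> normal_space z p \<longleftrightarrow> nip \<xi> (z_u z p) = 0 \<and> nip \<xi> (z_v z p) = 0"
proof
  have "z_u z p \<in> tangent_space z p" "z_v z p \<in> tangent_space z p"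
    unfolding tangent_space_def z_u_def z_v_def by auto
  then show "\<xi> \<in> normal_space z p \<Longrightarrow> nip \<xi> (z_u z p) = 0 \<and> nip \<xi> (z_v z p) = 0"
    by (simp add: normal_space_def)
qed (auto simp: normal_space_def tangent_space_iff[OF assms] nip_linear)

lemma nip_z:
  assumes "p \<in> U"
  shows "nip (z_u z p) (z_v z p) = 0" "nip (z_v z p) (z_u z p) = 0"
    "nip (n1 p) (z_u z p) = 0" "nip (n1 p) (z_v z p) = 0"
    "nip (n2 p) (z_u z p) = 0" "nip (n2 p) (z_v z p) = 0"
    "nip (z_u z p) (n1 p) = 0" "nip (z_v z p) (n1 p) = 0"
    "nip (z_u z p) (n2 p) = 0" "nip (z_v z p) (n2 p) = 0"
  using orthogonal[OF assms] n1_normal[OF assms] n2_normal[OF assms] nip_commute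
  by (auto simp: ff_F_def normal_space_iff[OF assms])

lemma frame_expansion:
  assumes "p \<in> U"
  shows "w = (nip w (z_u z p) / ff_E z p) *\<^sub>R z_u z p + (nip w (z_v z p) / ff_G z p) *\<^sub>R z_v z p
    + nip w (n1 p) *\<^sub>R n1 p - nip w (n2 p) *\<^sub>R n2 p"
proof -
  have "w = (nip w (z_u z p) / nip (z_u z p) (z_u z p)) *\<^sub>R z_u z p
    + (nip w (z_v z p) / nip (z_v z p) (z_v z p)) *\<^sub>R z_v z p
    + (nip w (n1 p) / nip (n1 p) (n1 p)) *\<^sub>R n1 p
    + (nip w (n2 p) / nip (n2 p) (n2 p)) *\<^sub>R n2 p"
    by (rule nip_orthogonal_expansion[OF oriented[OF assms]])
      (use E_pos[OF assms] G_neg[OF assms] in \<open>auto simp: nip_z nip_n assms ff_E_def ff_G_def\<close>)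
  then show ?thesis
    by (simp add: nip_n assms ff_E_def ff_G_def)
qed

lemma nip_frame_expansion:
  assumes "p \<in> U"
  shows "nip v w = nip v (z_u z p) * nip w (z_u z p) / ff_E z p
    + nip v (z_v z p) * nip w (z_v z p) / ff_G z p
    + nip v (n1 p) * nip w (n1 p) - nip v (n2 p) * nip w (n2 p)"
proof -
  have "nip v w = nip v ((nip w (z_u z p) / ff_E z p) *\<^sub>R z_u z p
    + (nip w (z_v z p) / ff_G z p) *\<^sub>R z_v z p
    + nip w (n1 p) *\<^sub>R n1 p - nip w (n2 p) *\<^sub>R n2 p)"
    by (rule arg_cong[OF frame_expansion[OF assms]])
  then show ?thesis
    by (simp add: nip_linear mult.commute)
qed

lemma nip_normal:
  assumes "p \<in> U" "\<xi> \<in> normal_space z p"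
  shows "nip \<xi> \<eta> = nip \<xi> (n1 p) * nip \<eta> (n1 p) - nip \<xi> (n2 p) * nip \<eta> (n2 p)"
  using nip_frame_expansion[OF assms(1), of \<xi> \<eta>] assms(2) by (simp add: normal_space_iff[OF assms(1)])

lemma normal_expansion:
  assumes "p \<in> U" "\<xi> \<in> normal_space z p"
  shows "\<xi> = nip \<xi> (n1 p) *\<^sub>R n1 p - nip \<xi> (n2 p) *\<^sub>R n2 p"
  using frame_expansion[OF assms(1), of \<xi>] assms(2) by (simp add: normal_space_iff[OF assms(1)])

lemma normal_part_eq:
  assumes "p \<in> U"
  shows "normal_part z p w = nip w (n1 p) *\<^sub>R n1 p - nip w (n2 p) *\<^sub>R n2 p" (is "_ = ?w")
  unfolding normal_part_def
proof (rule the_equality)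
  have "w - ?w = (nip w (z_u z p) / ff_E z p) *\<^sub>R z_u z p + (nip w (z_v z p) / ff_G z p) *\<^sub>R z_v z p"
    using frame_expansion[OF assms, of w] by (simp add: algebra_simps)
  then show "?w \<in> normal_space z p \<and> w - ?w \<in> tangent_space z p"
    using assms by (auto simp: normal_space_iff tangent_space_iff nip_linear nip_z)
next
  fix \<xi> assume \<xi>: "\<xi> \<in> normal_space z p \<and> w - \<xi> \<in> tangent_space z p"
  then obtain a b where t: "w - \<xi> = a *\<^sub>R z_u z p + b *\<^sub>R z_v z p"
    using assms by (auto simp: tangent_space_iff)
  have "nip (w - \<xi>) (n1 p) = 0" "nip (w - \<xi>) (n2 p) = 0"
    unfolding t by (simp_all add: nip_linear nip_z assms)
  then show "\<xi> = ?w"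
    using normal_expansion[OF assms, of \<xi>] \<xi> by (simp add: nip_linear)
qed

lemma normal_part_normal: "p \<in> U \<Longrightarrow> normal_part z p w \<in> normal_space z p"
  by (simp add: normal_part_eq normal_space_iff nip_linear nip_z)

lemma nip_normal_part:
  assumes "p \<in> U" "\<xi> \<in> normal_space z p"
  shows "nip (normal_part z p w) \<xi> = nip w \<xi>"
  using nip_normal[OF assms, of w]
  by (simp add: normal_part_eq assms nip_linear nip_commute)

text \<open>The symmetry of \<open>\<sigma>\<close> comes from here: the derivatives \<open>z\<^sub>u\<^sub>v\<close> and \<open>z\<^sub>v\<^sub>u\<close> coincide, so they
  share one coefficient.\<close>

lemma dd_dd_z:
  assumes "p \<in> U"
  shows "dd (dd z b) a p = (fst a * fst b) *\<^sub>R dd (z_u z) (1, 0) p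
    + (fst a * snd b + snd a * fst b) *\<^sub>R dd (z_u z) (0, 1) p
    + (snd a * snd b) *\<^sub>R dd (z_v z) (0, 1) p"
proof -
  have diff: "z_u z differentiable (at p)" "z_v z differentiable (at p)"
    using smooth_z_u smooth_z_v smooth_on_differentiable assms by blast+
  have D: "((\<lambda>q. fst b *\<^sub>R z_u z q + snd b *\<^sub>R z_v z q) has_derivative
      (\<lambda>a. fst b *\<^sub>R dd (z_u z) a p + snd b *\<^sub>R dd (z_v z) a p)) (at p)"
    by (intro has_derivative_add has_derivative_scaleR_right has_derivative_dd diff)
  have "dd (dd z b) a p = dd (\<lambda>q. fst b *\<^sub>R z_u z q + snd b *\<^sub>R z_v z q) a p"
    by (rule dd_transform_open[OF open_U assms dd_z]) (use D differentiableI in blast)+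
  also have "\<dots> = fst b *\<^sub>R dd (z_u z) a p + snd b *\<^sub>R dd (z_v z) a p"
    by (rule dd_eqI[OF D])
  finally have "dd (dd z b) a p = fst b *\<^sub>R dd (z_u z) a p + snd b *\<^sub>R dd (z_v z) a p" .
  moreover have "dd (z_v z) (1, 0) p = dd (z_u z) (0, 1) p"
    unfolding z_u_def z_v_def by (rule dd_commute[OF open_U assms smooth_z])
  ultimately show ?thesis
    using dd_coordinates[OF diff(1), of a] dd_coordinates[OF diff(2), of a]
    by (simp add: algebra_simps)
qed

lemma nip_second_form:
  assumes "p \<in> U" "n p \<in> normal_space z p"
  shows "nip (second_form z p a b) (n p) = fst a * fst b * c11 z n p
    + (fst a * snd b + snd a * fst b) * c12 z n p + snd a * snd b * c22 z n p"
  unfolding second_form_def nip_normal_part[OF assms] c11_def c12_def c22_def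
  by (simp add: dd_dd_z assms nip_linear)

text \<open>Differentiating \<open>\<langle>n, z\<^sub>u\<rangle> = 0\<close> and \<open>\<langle>n, z\<^sub>v\<rangle> = 0\<close> moves the derivative from the normal field to the
  tangent fields.\<close>

lemma weingarten:
  assumes "p \<in> U" "smooth_on U n" "\<And>q. q \<in> U \<Longrightarrow> n q \<in> normal_space z q"
  shows "nip (dd n (1, 0) p) (z_u z p) = - c11 z n p" "nip (dd n (0, 1) p) (z_u z p) = - c12 z n p"
    "nip (dd n (1, 0) p) (z_v z p) = - c12 z n p" "nip (dd n (0, 1) p) (z_v z p) = - c22 z n p"
proof -
  have diff: "n differentiable (at p)" "z_u z differentiable (at p)" "z_v z differentiable (at p)"
    using smooth_z_u smooth_z_v assms smooth_on_differentiable by blast+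
  have "nip (dd n a p) (z_u z p) = - nip (dd (z_u z) a p) (n p)"
    "nip (dd n a p) (z_v z p) = - nip (dd (z_v z) a p) (n p)" for a
    using dd_nip_const[OF open_U assms(1) diff(1,2), of 0 a]
      dd_nip_const[OF open_U assms(1) diff(1,3), of 0 a] assms(3)
    by (auto simp: normal_space_iff nip_commute[of "n p"])
  moreover have "dd (z_v z) (1, 0) p = dd (z_u z) (0, 1) p"
    unfolding z_u_def z_v_def by (rule dd_commute[OF open_U assms(1) smooth_z])
  ultimately show "nip (dd n (1, 0) p) (z_u z p) = - c11 z n p"
    "nip (dd n (0, 1) p) (z_u z p) = - c12 z n p"
    "nip (dd n (1, 0) p) (z_v z p) = - c12 z n p"
    "nip (dd n (0, 1) p) (z_v z p) = - c22 z n p"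
    by (simp_all add: c11_def c12_def c22_def)
qed


section \<open>The Ricci equation\<close>

lemma nip_dd_n:
  assumes "p \<in> U"
  shows "nip (dd n1 a p) (n1 p) = 0" "nip (dd n2 a p) (n2 p) = 0"
proof -
  have diff: "n1 differentiable (at p)" "n2 differentiable (at p)"
    using smooth_n1 smooth_n2 assms smooth_on_differentiable by blast+
  show "nip (dd n1 a p) (n1 p) = 0" "nip (dd n2 a p) (n2 p) = 0"
    using dd_nip_const[OF open_U assms diff(1) diff(1) nip_n(1), of a]
      dd_nip_const[OF open_U assms diff(2) diff(2) nip_n(2), of a]
    by (simp_all add: nip_commute[of "n1 p"] nip_commute[of "n2 p"])
qed

text \<open>The normal plane has dimension two and \<open>n\<^sub>2\<close> has constant length, so its normal derivative
  is a multiple of \<open>n\<^sub>1\<close>. The coefficient is the connection form of the normal bundle, and the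
  curvature is its exterior derivative.\<close>

lemma normal_connection_n2:
  "p \<in> U \<Longrightarrow> normal_connection z a n2 p = nip (dd n2 a p) (n1 p) *\<^sub>R n1 p"
  by (simp add: normal_connection_def normal_part_eq nip_dd_n)

lemma nip_normal_connection_twice:
  assumes "p \<in> U"
  shows "nip (normal_connection z a (normal_connection z b n2) p) (n1 p)
    = nip (dd (dd n2 b) a p) (n1 p) + nip (dd n2 b p) (dd n1 a p)"
proof -
  \<comment> \<open>The connection form on the tangent field with constant coordinates \<open>b\<close>.\<close>
  define \<omega> where "\<omega> q = nip (dd n2 b q) (n1 q)" for q
  have diff: "n1 differentiable (at p)" "dd n2 b differentiable (at p)"
    using smooth_n1 smooth_on_dd[OF smooth_n2] assms smooth_on_differentiable by blast+
  have \<omega>': "(\<omega> has_derivative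
      (\<lambda>h. nip (dd n2 b p) (dd n1 h p) + nip (dd (dd n2 b) h p) (n1 p))) (at p)"
    unfolding \<omega>_def by (intro nip.FDERIV has_derivative_dd diff)
  have D: "((\<lambda>q. \<omega> q *\<^sub>R n1 q) has_derivative (\<lambda>h. \<omega> p *\<^sub>R dd n1 h p
      + (nip (dd n2 b p) (dd n1 h p) + nip (dd (dd n2 b) h p) (n1 p)) *\<^sub>R n1 p)) (at p)"
    by (intro has_derivative_scaleR \<omega>' has_derivative_dd diff)
  have "dd (normal_connection z b n2) a p = dd (\<lambda>q. \<omega> q *\<^sub>R n1 q) a p"
    by (rule dd_transform_open[OF open_U assms])
      (use D differentiableI in \<open>auto simp: normal_connection_n2 \<omega>_def\<close>)
  then have "dd (normal_connection z b n2) a p = \<omega> p *\<^sub>R dd n1 a p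
      + (nip (dd n2 b p) (dd n1 a p) + nip (dd (dd n2 b) a p) (n1 p)) *\<^sub>R n1 p"
    using dd_eqI[OF D] by simp
  then show ?thesis
    unfolding normal_connection_def[of z a] nip_normal_part[OF assms n1_normal[OF assms]]
    by (simp add: nip_linear nip_dd_n nip_n assms)
qed

text \<open>The second derivatives of \<open>n\<^sub>2\<close> cancel because the ambient space is flat.\<close>

lemma nip_normal_curvature_tensor:
  assumes "p \<in> U"
  shows "nip (normal_curvature_tensor z a b n2 p) (n1 p)
    = nip (dd n2 b p) (dd n1 a p) - nip (dd n2 a p) (dd n1 b p)"
  using dd_commute[OF open_U assms smooth_n2, of a b]
  by (simp add: normal_curvature_tensor_def nip_linear nip_normal_connection_twice assms)

text \<open>In \<open>\<langle>dd n2 b, dd n1 a\<rangle>\<close> the normal parts do not contribute: that of \<open>dd n2 b\<close> is a multiple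
  of \<open>n\<^sub>1\<close> and that of \<open>dd n1 a\<close> a multiple of \<open>n\<^sub>2\<close>. The tangential parts are given by the
  Weingarten formulas.\<close>

lemma ricci_equation:
  assumes "p \<in> U"
  shows "nip (normal_curvature_tensor z a b n2 p) (n1 p)
    = (fst a * snd b - snd a * fst b)
      * (Delta1 z n1 n2 p / ff_E z p + Delta3 z n1 n2 p / ff_G z p)"
proof -
  have diff: "n1 differentiable (at p)" "n2 differentiable (at p)"
    using smooth_n1 smooth_n2 assms smooth_on_differentiable by blast+
  have tangential: "nip (dd n2 c p) (dd n1 d p)
      = nip (dd n2 c p) (z_u z p) * nip (dd n1 d p) (z_u z p) / ff_E z p
      + nip (dd n2 c p) (z_v z p) * nip (dd n1 d p) (z_v z p) / ff_G z p" for c d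
    using nip_frame_expansion[OF assms, of "dd n2 c p" "dd n1 d p"] by (simp add: nip_dd_n assms)
  have "nip (dd n2 b p) (dd n1 a p) - nip (dd n2 a p) (dd n1 b p)
    = (fst a * snd b - snd a * fst b)
      * (nip (dd n2 (0, 1) p) (dd n1 (1, 0) p) - nip (dd n2 (1, 0) p) (dd n1 (0, 1) p))"
    unfolding dd_coordinates[OF diff(1), of a] dd_coordinates[OF diff(1), of b]
      dd_coordinates[OF diff(2), of a] dd_coordinates[OF diff(2), of b]
    by (simp add: nip_linear algebra_simps)
  also have "nip (dd n2 (0, 1) p) (dd n1 (1, 0) p) - nip (dd n2 (1, 0) p) (dd n1 (0, 1) p)
    = Delta1 z n1 n2 p / ff_E z p + Delta3 z n1 n2 p / ff_G z p"
    unfolding tangential Delta1_def Delta3_def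
    by (simp add: weingarten assms smooth_n1 smooth_n2 n1_normal n2_normal algebra_simps
        diff_divide_distrib)
  finally show ?thesis
    unfolding nip_normal_curvature_tensor[OF assms] .
qed

lemma W_eq: "p \<in> U \<Longrightarrow> ff_W z p = sqrt (ff_E z p) * sqrt (- ff_G z p)"
  using E_pos[of p] G_neg[of p] mult_pos_neg[of "ff_E z p" "ff_G z p"]
  by (simp add: ff_W_def orthogonal real_sqrt_mult[symmetric])

lemma varkappa_eq:
  assumes "p \<in> U"
  shows "inv_varkappa z n1 n2 p
    = (Delta1 z n1 n2 p / ff_E z p + Delta3 z n1 n2 p / ff_G z p) / ff_W z p"
  using E_pos[OF assms] G_neg[OF assms]
  by (simp add: inv_varkappa_def inv_L_def inv_N_def orthogonal assms W_eq field_simps)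

lemma normal_curvature_eq_varkappa:
  assumes "p \<in> U"
  shows "normal_curvature z n1 n2 p = inv_varkappa z n1 n2 p"
  unfolding normal_curvature_def ricci_equation[OF assms] varkappa_eq[OF assms]
  using E_pos[OF assms] G_neg[OF assms]
  by (simp add: frame_x_def frame_y_def orthogonal assms field_simps)


section \<open>The mean curvature vector\<close>

lemma mean_curvature_normal: "p \<in> U \<Longrightarrow> mean_curvature_vector z p \<in> normal_space z p"
  using normal_part_normal
  by (simp add: mean_curvature_vector_def second_form_def normal_space_iff nip_linear)

text \<open>The Gram-Schmidt frame that defines the mean curvature vector is the principal frame when the
  parameters are orthogonal; the first vectors agree by definition.\<close>

lemma frame_y_eq: "p \<in> U \<Longrightarrow> frame_y z p = princ_y z p"
  using E_pos[of p] G_neg[of p]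
  by (simp add: frame_y_def princ_y_def orthogonal W_eq field_simps)

lemma nip_mean_curvature:
  assumes "p \<in> U" "n p \<in> normal_space z p"
  shows "nip (mean_curvature_vector z p) (n p) = (c11 z n p / ff_E z p + c22 z n p / ff_G z p) / 2"
  using E_pos[OF assms(1)] G_neg[OF assms(1)]
  by (simp add: mean_curvature_vector_def nip_linear nip_second_form[where n = n, OF assms]
      frame_y_eq[OF assms(1)] frame_x_def princ_y_def algebra_simps)

text \<open>The definition of \<open>H\<close> through normal projections at single points hides its continuity. The
  products of \<open>H\<close> with the smooth fields \<open>n\<^sub>1, n\<^sub>2\<close> are visibly continuous.\<close>

lemma continuous_nip_mean_curvature:
  "continuous_on U (\<lambda>p. nip (mean_curvature_vector z p) (mean_curvature_vector z p))"
proof -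
  define h where "h n p = (c11 z n p / ff_E z p + c22 z n p / ff_G z p) / 2" for n p
  have cont: "continuous_on U (h n)" if "smooth_on U n" for n
    unfolding h_def c11_def c22_def ff_E_def ff_G_def
    by (intro continuous_intros nip.continuous_on smooth_on_continuous smooth_on_dd
        smooth_z_u smooth_z_v that)
      (use E_pos G_neg in \<open>force simp: ff_E_def ff_G_def\<close>)+
  have "continuous_on U (\<lambda>p. (h n1 p)\<^sup>2 - (h n2 p)\<^sup>2)"
    by (intro continuous_intros cont smooth_n1 smooth_n2)
  moreover have "nip (mean_curvature_vector z p) (mean_curvature_vector z p) = (h n1 p)\<^sup>2 - (h n2 p)\<^sup>2"
    if "p \<in> U" for p
    using nip_normal[OF that mean_curvature_normal[OF that], of "mean_curvature_vector z p"]
    by (simp add: nip_mean_curvature that n1_normal n2_normal h_def power2_eq_square)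
  ultimately show ?thesis
    by (simp cong: continuous_on_cong_simp)
qed

lemma eps_constant:
  assumes "\<And>p. p \<in> U \<Longrightarrow> nip (mean_curvature_vector z p) (mean_curvature_vector z p) \<noteq> 0"
  shows "eps z constant_on U"
proof -
  define f where "f p = nip (mean_curvature_vector z p) (mean_curvature_vector z p)" for p
  have "connected (f ` U)"
    unfolding f_def by (intro connected_continuous_image continuous_nip_mean_curvature connected_U)
  have nonzero: "f p \<noteq> 0" if "p \<in> U" for p
    using assms that by (simp add: f_def)
  have "\<not> (f p < 0 \<and> 0 < f q)" if "p \<in> U" "q \<in> U" for p q
  proof
    assume "f p < 0 \<and> 0 < f q"
    then have "0 \<in> f ` U"
      using connectedD_interval[OF \<open>connected (f ` U)\<close>, of "f p" "f q" 0] that by simp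
    then show False
      using nonzero by auto
  qed
  then have sgn_eq: "sgn (f p) = sgn (f q)" if "p \<in> U" "q \<in> U" for p q
    using nonzero[of p] nonzero[of q] that by (metis linorder_neqE_linordered_idom sgn_neg sgn_pos)
  show ?thesis
  proof (cases "U = {}")
    case False
    then obtain q where "q \<in> U"
      by blast
    then have "\<forall>p\<in>U. sgn (f p) = sgn (f q)"
      using sgn_eq by blast
    then show ?thesis
      unfolding constant_on_def eps_def f_def by blast
  qed (simp add: constant_on_def)
qed

end


section \<open>The normal curvature in terms of the geometric functions\<close>

text \<open>Here \<open>\<alpha>, \<delta>, \<gamma>, b\<close> are the products of \<open>\<sigma>(x,x)\<close>, \<open>\<sigma>(y,y)\<close>, \<open>\<sigma>(x,y)\<close> and \<open>b\<close> with
  \<open>n\<^sub>1, n\<^sub>2\<close>. Since \<open>b\<close> is proportional to \<open>\<alpha> - \<delta>\<close> and \<open>\<alpha>\<close>, \<open>\<delta>\<close> are proportional to each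
  other, both are proportional to \<open>b\<close>, and each contributes one instance of \<open>key\<close>.\<close>

lemma normal_plane_identity:
  fixes \<epsilon> :: real
  assumes "\<alpha>1 * \<delta>2 = \<delta>1 * \<alpha>2"
    and b: "b1 = \<beta> * (\<alpha>1 - \<delta>1)" "b2 = \<beta> * (\<alpha>2 - \<delta>2)" "b1\<^sup>2 - b2\<^sup>2 = \<epsilon>"
  shows "(\<gamma>2 * b1 - \<gamma>1 * b2) * ((\<alpha>1 * b1 - \<alpha>2 * b2) + (\<delta>1 * b1 - \<delta>2 * b2))
    = \<epsilon> * ((\<alpha>1 + \<delta>1) * \<gamma>2 - (\<alpha>2 + \<delta>2) * \<gamma>1)"
proof -
  have key: "(\<gamma>2 * b1 - \<gamma>1 * b2) * (x1 * b1 - x2 * b2) = \<epsilon> * (x1 * \<gamma>2 - x2 * \<gamma>1)"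
    if "x1 * b2 = x2 * b1" for x1 x2
    using that b(3) by algebra
  have "\<alpha>1 * b2 = \<alpha>2 * b1" "\<delta>1 * b2 = \<delta>2 * b1"
    using assms(1) unfolding b(1,2) by algebra+
  then show ?thesis
    using key[of \<alpha>1 \<alpha>2] key[of \<delta>1 \<delta>2] by (simp add: algebra_simps)
qed

text \<open>The lengths of \<open>b\<close> and \<open>l\<close> and their orthogonality determine \<open>l\<close> up to sign and force
  \<open>t\<^sup>2 = 1\<close> for \<open>t = b2 * l1 - b1 * l2\<close>. The sign is fixed by the orientation of the frame, in
  which \<open>b\<close> and \<open>l\<close> change places when \<open>\<epsilon> = -1\<close>; this is why the condition reads \<open>\<epsilon> t > 0\<close>.
  So \<open>t = \<epsilon>\<close>, and \<open>l\<close> solves a linear system.\<close>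

lemma oriented_unit_normal_components:
  fixes \<epsilon> :: real
  assumes "\<epsilon> = 1 \<or> \<epsilon> = -1"
    and b: "b1\<^sup>2 - b2\<^sup>2 = \<epsilon>" and l: "l1\<^sup>2 - l2\<^sup>2 = - \<epsilon>" and orth: "b1 * l1 - b2 * l2 = 0"
    and sign: "\<epsilon> * (b2 * l1 - b1 * l2) > 0"
  shows "l1 = - b2" "l2 = - b1"
proof -
  have e: "\<epsilon> * \<epsilon> = 1"
    using assms(1) by auto
  have "(b2 * l1 - b1 * l2)\<^sup>2 = (b1 * l1 - b2 * l2)\<^sup>2 - (b1\<^sup>2 - b2\<^sup>2) * (l1\<^sup>2 - l2\<^sup>2)"
    by (simp add: power2_eq_square algebra_simps)
  then have "(\<epsilon> * (b2 * l1 - b1 * l2))\<^sup>2 = 1"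
    unfolding b l orth by (simp add: power_mult_distrib) (simp add: power2_eq_square e)
  then have d: "b2 * l1 - b1 * l2 = \<epsilon>"
    using sign assms(1) by (auto simp: power2_eq_1_iff)
  have "\<epsilon> * l1 = b1 * (b1 * l1) - b2 * (b2 * l1)" "\<epsilon> * l2 = b1 * (b1 * l2) - b2 * (b2 * l2)"
    unfolding b[symmetric] by (simp_all add: power2_eq_square algebra_simps)
  moreover have "b1 * l1 = b2 * l2" "b2 * l1 = \<epsilon> + b1 * l2" "b1 * l2 = b2 * l1 - \<epsilon>"
    using orth d by simp_all
  ultimately have "\<epsilon> * (l1 + b2) = 0" "\<epsilon> * (l2 + b1) = 0"
    by algebra+
  then show "l1 = - b2" "l2 = - b1"
    using assms(1) by auto
qed


context orthogonal_surface
begin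

lemma field_b_unit:
  assumes "nip (mean_curvature_vector z p) (mean_curvature_vector z p) \<noteq> 0"
  shows "nip (field_b z p) (field_b z p) = eps z p"
  using assms by (simp add: field_b_def eps_def nip_linear sgn_real_def)

text \<open>Everything is expressed by products with \<open>n\<^sub>1, n\<^sub>2\<close>; the claim then is
  \<open>normal_plane_identity\<close>.\<close>

lemma geometric_functions_eq_varkappa:
  assumes p: "p \<in> U"
    and nonnull: "nip (mean_curvature_vector z p) (mean_curvature_vector z p) \<noteq> 0"
    and M: "inv_M z n1 n2 p = 0"
    and l: "is_field_l U z l"
  shows "mu z l p * (nu1 z p + nu2 z p) = eps z p * inv_varkappa z n1 n2 p"
proof -
  define \<epsilon> where "\<epsilon> = eps z p"
  have \<epsilon>: "\<epsilon> = 1 \<or> \<epsilon> = -1"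
    using nonnull by (auto simp: \<epsilon>_def eps_def sgn_real_def)
  define b where "b = field_b z p"
  obtain \<beta> where \<beta>: "b = \<beta> *\<^sub>R mean_curvature_vector z p"
    unfolding b_def field_b_def by blast
  have b_normal: "b \<in> normal_space z p"
    using mean_curvature_normal[OF p] by (simp add: \<beta> normal_space_iff p nip_linear)
  have l_normal: "l p \<in> normal_space z p" and l_norm: "nip (l p) (l p) = - \<epsilon>"
    and bl: "nip b (l p) = 0"
    and pos1: "\<epsilon> = 1 \<Longrightarrow> pos_oriented (dd z (princ_x z p) p) (dd z (princ_y z p) p) b (l p)"
    and pos2: "\<epsilon> = -1 \<Longrightarrow> pos_oriented (dd z (princ_x z p) p) (dd z (princ_y z p) p) (l p) b"
    using l p by (auto simp: is_field_l_def \<epsilon>_def b_def)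
  define b1 b2 l1 l2 where "b1 = nip b (n1 p)" and "b2 = nip b (n2 p)"
    and "l1 = nip (l p) (n1 p)" and "l2 = nip (l p) (n2 p)"
  have expand: "b = b1 *\<^sub>R n1 p + (- b2) *\<^sub>R n2 p" "l p = l1 *\<^sub>R n1 p + (- l2) *\<^sub>R n2 p"
    using normal_expansion[OF p b_normal] normal_expansion[OF p l_normal]
    by (simp_all add: b1_def b2_def l1_def l2_def)
  have nip_b: "b1\<^sup>2 - b2\<^sup>2 = \<epsilon>" and nip_l: "l1\<^sup>2 - l2\<^sup>2 = - \<epsilon>" and nip_bl: "b1 * l1 - b2 * l2 = 0"
    using nip_normal[OF p b_normal, of b] nip_normal[OF p l_normal, of "l p"]
      nip_normal[OF p b_normal, of "l p"] field_b_unit[OF nonnull] l_norm bl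
    by (simp_all add: power2_eq_square b1_def b2_def l1_def l2_def \<epsilon>_def b_def)
  have E: "sqrt (ff_E z p) > 0" and G: "sqrt (- ff_G z p) > 0"
    using E_pos[OF p] G_neg[OF p] by simp_all
  have frame_det: "det (vector [z_u z p, z_v z p, n1 p, n2 p] :: real^4^4) > 0"
    using oriented[OF p] by (simp add: pos_oriented_def)
  have xy: "dd z (princ_x z p) p = (1 / sqrt (ff_E z p)) *\<^sub>R z_u z p"
    "dd z (princ_y z p) p = (1 / sqrt (- ff_G z p)) *\<^sub>R z_v z p"
    by (simp_all add: dd_z p princ_x_def princ_y_def)
  \<comment> \<open>As \<open>(x, y, n1, n2)\<close> is positively oriented, the orientation of another frame with the same
      tangent vectors is the sign of the determinant \<open>X\<close> of the change of basis in the normal plane.\<close>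
  have sign: "X > 0"
    if "1 / sqrt (ff_E z p) * (1 / sqrt (- ff_G z p)) * X
      * det (vector [z_u z p, z_v z p, n1 p, n2 p] :: real^4^4) > 0" for X
    using that E G frame_det
    by (metis divide_pos_pos mult_pos_pos zero_less_mult_pos zero_less_mult_pos2 zero_less_one)
  have "\<epsilon> * (b2 * l1 - b1 * l2) > 0"
    using \<epsilon>
  proof
    assume e: "\<epsilon> = 1"
    show ?thesis
      using sign[OF pos1[OF e, unfolded pos_oriented_def xy expand det4_normal_block]] e by simp
  next
    assume e: "\<epsilon> = -1"
    show ?thesis
      using sign[OF pos2[OF e, unfolded pos_oriented_def xy expand det4_normal_block]] e
      by (simp add: mult.commute)
  qed
  then have l_eq: "l1 = - b2" "l2 = - b1"
    using oriented_unit_normal_components[OF \<epsilon> nip_b nip_l nip_bl] by blast+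

  define \<alpha> where "\<alpha> n = c11 z n p / ff_E z p" for n
  define \<delta> where "\<delta> n = - c22 z n p / ff_G z p" for n
  define \<gamma> where "\<gamma> n = c12 z n p / ff_W z p" for n
  have \<sigma>: "nip (second_form z p (princ_x z p) (princ_x z p)) (n p) = \<alpha> n"
    "nip (second_form z p (princ_y z p) (princ_y z p)) (n p) = \<delta> n"
    "nip (second_form z p (princ_x z p) (princ_y z p)) (n p) = \<gamma> n"
    if "n p \<in> normal_space z p" for n
    using E_pos[OF p] G_neg[OF p]
    by (simp_all add: nip_second_form[where n = n, OF p that] princ_x_def princ_y_def
        \<alpha>_def \<delta>_def \<gamma>_def W_eq p)
  have \<sigma>_normal: "second_form z p v w \<in> normal_space z p" for v w
    unfolding second_form_def by (rule normal_part_normal[OF p])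
  have nu: "nu1 z p = \<alpha> n1 * b1 - \<alpha> n2 * b2" "nu2 z p = \<delta> n1 * b1 - \<delta> n2 * b2"
    and mu: "mu z l p = \<gamma> n1 * l1 - \<gamma> n2 * l2"
    unfolding nu1_def nu2_def mu_def b_def[symmetric] nip_normal[OF p \<sigma>_normal, of _ _ b]
      nip_normal[OF p \<sigma>_normal, of _ _ "l p"]
    by (simp_all add: \<sigma> n1_normal n2_normal p b1_def b2_def l1_def l2_def)
  have mean: "b1 = \<beta> / 2 * (\<alpha> n1 - \<delta> n1)" "b2 = \<beta> / 2 * (\<alpha> n2 - \<delta> n2)"
    by (simp_all add: b1_def b2_def \<beta> nip_linear nip_mean_curvature p n1_normal n2_normal
        \<alpha>_def \<delta>_def)
  have "Delta2 z n1 n2 p = 0"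
    using M E G by (simp add: inv_M_def W_eq p)
  then have parallel: "\<alpha> n1 * \<delta> n2 = \<delta> n1 * \<alpha> n2"
    by (simp add: Delta2_def \<alpha>_def \<delta>_def mult.commute)
  have "mu z l p * (nu1 z p + nu2 z p)
    = (\<gamma> n2 * b1 - \<gamma> n1 * b2) * ((\<alpha> n1 * b1 - \<alpha> n2 * b2) + (\<delta> n1 * b1 - \<delta> n2 * b2))"
    unfolding nu mu l_eq by (simp add: algebra_simps)
  also have "\<dots> = \<epsilon> * ((\<alpha> n1 + \<delta> n1) * \<gamma> n2 - (\<alpha> n2 + \<delta> n2) * \<gamma> n1)"
    by (rule normal_plane_identity[OF parallel mean nip_b])
  also have "(\<alpha> n1 + \<delta> n1) * \<gamma> n2 - (\<alpha> n2 + \<delta> n2) * \<gamma> n1 = inv_varkappa z n1 n2 p"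
    unfolding varkappa_eq[OF p] Delta1_def Delta3_def \<alpha>_def \<delta>_def \<gamma>_def
    by (simp add: algebra_simps add_divide_distrib diff_divide_distrib)
  finally show ?thesis
    by (simp add: \<epsilon>_def)
qed

end

theorem proposition5p4:
  fixes U :: "(real \<times> real) set" and z n1 n2 l :: "real \<times> real \<Rightarrow> real^4"
  assumes "lorentz_surface U z"
    and "normal_frame U z n1 n2"
    and "general_type U z n1 n2"
    and "principal_parameters U z n1 n2"
    and "is_field_l U z l"
  shows "normal_curvature z n1 n2 constant_on U \<longleftrightarrow>
         (\<lambda>p. mu z l p * (nu1 z p + nu2 z p)) constant_on U"
proof -
  interpret orthogonal_surface U z n1 n2
    using assms by unfold_locales (auto simp: principal_parameters_def)
  have nonnull: "nip (mean_curvature_vector z p) (mean_curvature_vector z p) \<noteq> 0" if "p \<in> U" for p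
    using assms(3) that by (auto simp: general_type_def)
  obtain \<epsilon> where \<epsilon>: "\<And>p. p \<in> U \<Longrightarrow> eps z p = \<epsilon>"
    using eps_constant nonnull unfolding constant_on_def by metis
  have eq: "mu z l p * (nu1 z p + nu2 z p) = \<epsilon> * normal_curvature z n1 n2 p" if "p \<in> U" for p
    using geometric_functions_eq_varkappa[OF that nonnull[OF that] _ assms(5)] assms(4) that \<epsilon>
    by (simp add: principal_parameters_def normal_curvature_eq_varkappa)
  show ?thesis
  proof
    assume "normal_curvature z n1 n2 constant_on U"
    then show "(\<lambda>p. mu z l p * (nu1 z p + nu2 z p)) constant_on U"
      unfolding constant_on_def using eq by metis
  next
    assume "(\<lambda>p. mu z l p * (nu1 z p + nu2 z p)) constant_on U"
    then obtain c where c: "\<And>p. p \<in> U \<Longrightarrow> \<epsilon> * normal_curvature z n1 n2 p = c"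
      unfolding constant_on_def using eq by metis
    have "normal_curvature z n1 n2 p = \<epsilon> * c" if "p \<in> U" for p
    proof -
      have "\<epsilon> * \<epsilon> = 1"
        using nonnull[OF that] by (auto simp: \<epsilon>[OF that, symmetric] eps_def sgn_real_def)
      then show ?thesis
        unfolding c[OF that, symmetric] by (simp flip: mult.assoc)
    qed
    then show "normal_curvature z n1 n2 constant_on U"
      unfolding constant_on_def by blast
  qed
qed

end
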